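(* Let $\{A_j\}_{j\in\mathbb J},\{B_j\}_{j\in\mathbb J}\in\mathscr F$ and let $M:=\Phi_A(\{B_j\}_{j\in\mathbb J})=\theta_BS_A^{-1}\theta_A^*$. Then the following conditions are equivalent. (i) $\{B_j\}_{j\in\mathbb J}$ is a dual of $\{A_j\}_{j\in\mathbb J}$. (ii) $\sum_{j\in\mathbb J}B_j^*A_j=I$, where the convergence is in the strong operator topology. (iii) $P_AMP_A=\theta_AS_A^{-2}\theta_A^*$. In particular, $\{B_j\}_{j\in\mathbb J}$ is the canonical dual of $\{A_j\}_{j\in\mathbb J}$ if and only if $M=P_AMP_A$.
   Context: Fix Hilbert spaces $H,H_o$ and an index set $\mathbb J$. $\mathscr F$ is the set of operator-valued frames on $H$ with range in $H_o$ indexed by $\mathbb J$: families $\{A_j\}_{j\in\mathbb J}\subset B(H,H_o)$ such that $S_A:=\sum_{j\in\mathbb J}A_j^*A_j$ converges in the strong operator topology (net of finite partial sums) to a bounded positive invertible operator. $L_j:H_o\to\ell^2(\mathbb J)\otimes H_o$ is $L_jh=e_j\otimes h$, with $\{e_j\}$ the standard basis of $\ell^2(\mathbb J)$. The analysis operator is $\theta_A:=\sum_{j\in\mathbb J}L_jA_j\in B(H,\ell^2(\mathbb J)\otimes H_o)$ (strong convergence), and the frame projection $P_A:=\theta_AS_A^{-1}\theta_A^*$ is the range projection of $\theta_A$; $\theta_B$ is defined in the same way from $\{B_j\}$. $\{B_j\}\in\mathscr F$ is called a dual of $\{A_j\}\in\mathscr F$ if $\theta_B^*\theta_A=I$. The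 canonical dual of $\{A_j\}$ is $\{A_jS_A^{-1}\}_{j\in\mathbb J}$.
   Formalization: The last sentence is false as written (one index, A=1, B=2 on the complex numbers gives M=P_A M P_A, but B is not canonical); it is proved as: B is the canonical dual of A iff B is a dual of A and M=P_A M P_A. *)

theory Defs
  imports "HOL-Analysis.Elementary_Metric_Spaces" "HOL-Analysis.Inner_Product"
    "HOL-Analysis.Infinite_Sum" "HOL-Library.Nonpos_Ints"
begin

section \<open>Complex Hilbert spaces\<close>

text \<open>
  A complex inner product space is a real one (with inner product \<open>Re \<langle>x, y\<rangle>\<close>, hence the same
  norm and topology) with a compatible complex structure. The inner product is linear in its first
  argument. Positive definiteness of \<open>cinner\<close> follows from that of \<open>inner\<close>.
\<close>

class complex_inner = real_inner +
  fixes scaleC :: "complex \<Rightarrow> 'a \<Rightarrow> 'a"  (infixr \<open>*\<^sub>C\<close> 75)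
    and cinner :: "'a \<Rightarrow> 'a \<Rightarrow> complex"
  assumes scaleC_add_right: "c *\<^sub>C (x + y) = c *\<^sub>C x + c *\<^sub>C y"
    and scaleC_add_left: "(c + d) *\<^sub>C x = c *\<^sub>C x + d *\<^sub>C x"
    and scaleC_scaleC: "c *\<^sub>C d *\<^sub>C x = (c * d) *\<^sub>C x"
    and scaleR_scaleC: "r *\<^sub>R x = of_real r *\<^sub>C x"
    and cinner_commute: "cinner x y = cnj (cinner y x)"
    and cinner_add_left: "cinner (x + y) z = cinner x z + cinner y z"
    and cinner_scaleC_left: "cinner (c *\<^sub>C x) y = c * cinner x y"
    and Re_cinner: "Re (cinner x y) = inner x y"

class chilbert_space = complex_inner + complete_space

lemma cinner_self: "cinner x x = of_real ((norm x)\<^sup>2)" for x :: "'a::complex_inner"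
proof (rule complex_eqI)
  show "Re (cinner x x) = Re (of_real ((norm x)\<^sup>2))"
    by (simp add: Re_cinner power2_norm_eq_inner)
  have "Im (cinner x x) = - Im (cinner x x)"
    using arg_cong [OF cinner_commute [of x x], of Im] by (simp only: cnj.sel)
  then show "Im (cinner x x) = Im (of_real ((norm x)\<^sup>2))" by simp
qed

lemma cinner_scaleC_right: "cinner x (c *\<^sub>C y) = cnj c * cinner x y"
  for x y :: "'a::complex_inner"
  by (metis cinner_commute cinner_scaleC_left complex_cnj_mult)

lemma norm_scaleC: "norm (c *\<^sub>C x) = cmod c * norm x" for x :: "'a::complex_inner"
proof -
  have "complex_of_real ((norm (c *\<^sub>C x))\<^sup>2) = (c * cnj c) * of_real ((norm x)\<^sup>2)"
    by (simp only: cinner_self [symmetric] cinner_scaleC_left cinner_scaleC_right mult_ac)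
  also have "\<dots> = of_real ((cmod c * norm x)\<^sup>2)"
    by (simp only: complex_norm_square [symmetric] of_real_mult power_mult_distrib of_real_power)
  finally have "(norm (c *\<^sub>C x))\<^sup>2 = (cmod c * norm x)\<^sup>2"
    by (simp only: of_real_eq_iff)
  then show ?thesis by (simp add: power2_eq_iff_nonneg)
qed

lemma Im_cinner: "Im (cinner x y) = - inner (\<i> *\<^sub>C x) y" for x y :: "'a::complex_inner"
  by (simp add: Re_cinner [symmetric] cinner_scaleC_left)

lemma cinner_eq: "cinner x y = of_real (inner x y) - \<i> * of_real (inner (\<i> *\<^sub>C x) y)"
  for x y :: "'a::complex_inner"
  by (rule complex_eqI) (simp_all add: Re_cinner Im_cinner)

instantiation complex :: chilbert_space
begin

definition "c *\<^sub>C x = c * x" for c x :: complex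
definition "cinner x y = x * cnj y" for x y :: complex

instance
  by standard
    (simp_all add: scaleC_complex_def cinner_complex_def algebra_simps scaleR_conv_of_real
      inner_complex_def)

end


section \<open>The space \<open>\<ell>\<^sup>2(J) \<otimes> H\<close>\<close>

text \<open>
  The Hilbert space tensor product \<open>\<ell>\<^sup>2(J) \<otimes> H\<close> is realised as the space of square-summable
  families in \<open>H\<close> indexed by the type \<open>'j\<close>, with \<open>a \<otimes> h\<close> the family \<open>j \<mapsto> a\<^sub>j h\<close>. The lemmas
  \<open>cinner_tensor\<close> and \<open>closure_span_tensor\<close> below are the two properties that characterise the
  Hilbert space tensor product up to unitary equivalence.
\<close>

typedef (overloaded) ('j, 'a::complex_inner) ell2 =
  "{f :: 'j \<Rightarrow> 'a. (\<lambda>j. (norm (f j))\<^sup>2) summable_on UNIV}"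
  by (rule exI [of _ "\<lambda>_. 0"]) simp

lemma ell2_summable: "(\<lambda>j. (norm (Rep_ell2 f j))\<^sup>2) summable_on UNIV"
  using Rep_ell2 [of f] by simp

lemma summable_on_bound:
  fixes f g :: "'j \<Rightarrow> real"
  assumes "g summable_on UNIV" and "\<And>j. \<bar>f j\<bar> \<le> g j"
  shows "f summable_on UNIV"
proof (rule abs_summable_summable)
  show "f abs_summable_on UNIV"
    by (rule summable_on_comparison_test [OF assms(1)]) (use assms(2) in auto)
qed

lemma Rep_Abs_ell2:
  assumes "(\<lambda>j. (norm (f j))\<^sup>2) summable_on UNIV"
  shows "Rep_ell2 (Abs_ell2 f) = f"
  using assms by (simp add: Abs_ell2_inverse)

lemma ell2_summable_add:
  fixes f g :: "'j \<Rightarrow> 'a::complex_inner"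
  assumes "(\<lambda>j. (norm (f j))\<^sup>2) summable_on UNIV" "(\<lambda>j. (norm (g j))\<^sup>2) summable_on UNIV"
  shows "(\<lambda>j. (norm (f j + g j))\<^sup>2) summable_on UNIV"
proof (rule summable_on_bound)
  show "(\<lambda>j. 2 * (norm (f j))\<^sup>2 + 2 * (norm (g j))\<^sup>2) summable_on UNIV"
    by (intro summable_on_add summable_on_cmult_right assms)
  fix j
  have "(norm (f j + g j))\<^sup>2 \<le> (norm (f j) + norm (g j))\<^sup>2"
    by (simp add: norm_triangle_ineq power_mono)
  also have "\<dots> \<le> 2 * (norm (f j))\<^sup>2 + 2 * (norm (g j))\<^sup>2"
    using sum_squares_bound [of "norm (f j)" "norm (g j)"] by (simp add: power2_sum)
  finally show "\<bar>(norm (f j + g j))\<^sup>2\<bar> \<le> 2 * (norm (f j))\<^sup>2 + 2 * (norm (g j))\<^sup>2" by simp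
qed

lemma ell2_summable_scaleC:
  fixes f :: "'j \<Rightarrow> 'a::complex_inner"
  assumes "(\<lambda>j. (norm (f j))\<^sup>2) summable_on UNIV"
  shows "(\<lambda>j. (norm (c *\<^sub>C f j))\<^sup>2) summable_on UNIV"
  using summable_on_cmult_right [OF assms, of "(cmod c)\<^sup>2"]
  by (simp add: norm_scaleC power_mult_distrib)

lemma ell2_summable_inner:
  fixes f g :: "'j \<Rightarrow> 'a::complex_inner"
  assumes "(\<lambda>j. (norm (f j))\<^sup>2) summable_on UNIV" "(\<lambda>j. (norm (g j))\<^sup>2) summable_on UNIV"
  shows "(\<lambda>j. inner (f j) (g j)) summable_on UNIV"
proof (rule summable_on_bound)
  show "(\<lambda>j. (norm (f j))\<^sup>2 + (norm (g j))\<^sup>2) summable_on UNIV"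
    by (intro summable_on_add assms)
  fix j
  have "\<bar>inner (f j) (g j)\<bar> \<le> norm (f j) * norm (g j)" by (rule Cauchy_Schwarz_ineq2)
  also have "\<dots> \<le> (norm (f j))\<^sup>2 + (norm (g j))\<^sup>2"
    using sum_squares_bound [of "norm (f j)" "norm (g j)"]
      mult_nonneg_nonneg [OF norm_ge_zero [of "f j"] norm_ge_zero [of "g j"]] by linarith
  finally show "\<bar>inner (f j) (g j)\<bar> \<le> (norm (f j))\<^sup>2 + (norm (g j))\<^sup>2" .
qed

lemma ell2_summable_cinner:
  fixes f g :: "'j \<Rightarrow> 'a::complex_inner"
  assumes "(\<lambda>j. (norm (f j))\<^sup>2) summable_on UNIV" "(\<lambda>j. (norm (g j))\<^sup>2) summable_on UNIV"
  shows "(\<lambda>j. cinner (f j) (g j)) summable_on UNIV"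
proof -
  have "(\<lambda>j. complex_of_real (inner (f j) (g j))
      + (- \<i>) * complex_of_real (inner (\<i> *\<^sub>C f j) (g j))) summable_on UNIV"
    by (intro summable_on_add summable_on_cmult_right summable_on_of_real
        ell2_summable_inner ell2_summable_scaleC assms)
  then show ?thesis by (simp add: cinner_eq [of "f _"])
qed

instantiation ell2 :: (type, complex_inner) complex_inner
begin

definition "0 = Abs_ell2 (\<lambda>_. 0)"
definition "f + g = Abs_ell2 (\<lambda>j. Rep_ell2 f j + Rep_ell2 g j)"
definition "f - g = Abs_ell2 (\<lambda>j. Rep_ell2 f j - Rep_ell2 g j)"
definition "- f = Abs_ell2 (\<lambda>j. - Rep_ell2 f j)"
definition "r *\<^sub>R f = Abs_ell2 (\<lambda>j. r *\<^sub>R Rep_ell2 f j)" for f :: "('a, 'b) ell2"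
definition "c *\<^sub>C f = Abs_ell2 (\<lambda>j. c *\<^sub>C Rep_ell2 f j)"
definition "inner f g = (\<Sum>\<^sub>\<infinity>j. inner (Rep_ell2 f j) (Rep_ell2 g j))"
definition "cinner f g = (\<Sum>\<^sub>\<infinity>j. cinner (Rep_ell2 f j) (Rep_ell2 g j))"
definition "norm f = sqrt (inner f f)" for f :: "('a, 'b) ell2"
definition "dist f g = norm (f - g)" for f g :: "('a, 'b) ell2"
definition "sgn f = inverse (norm f) *\<^sub>R f" for f :: "('a, 'b) ell2"
definition "(uniformity :: (('a, 'b) ell2 \<times> ('a, 'b) ell2) filter) =
  (INF e\<in>{0<..}. principal {(x, y). dist x y < e})"
definition "open U = (\<forall>x\<in>U. eventually (\<lambda>(x', y). x' = x \<longrightarrow> y \<in> U) uniformity)"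
  for U :: "('a, 'b) ell2 set"

lemma Rep_ell2_zero: "Rep_ell2 0 j = 0"
  by (simp add: zero_ell2_def Rep_Abs_ell2)

lemma Rep_ell2_add: "Rep_ell2 (f + g) j = Rep_ell2 f j + Rep_ell2 g j"
  by (simp add: plus_ell2_def Rep_Abs_ell2 ell2_summable_add ell2_summable)

lemma Rep_ell2_uminus: "Rep_ell2 (- f) j = - Rep_ell2 f j"
  by (simp add: uminus_ell2_def Rep_Abs_ell2 ell2_summable)

lemma Rep_ell2_diff: "Rep_ell2 (f - g) j = Rep_ell2 f j - Rep_ell2 g j"
proof -
  have "(\<lambda>j. (norm (Rep_ell2 f j + - Rep_ell2 g j))\<^sup>2) summable_on UNIV"
    by (rule ell2_summable_add) (simp_all add: ell2_summable)
  then show ?thesis by (simp add: minus_ell2_def Rep_Abs_ell2)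
qed

lemma Rep_ell2_scaleC: "Rep_ell2 (c *\<^sub>C f) j = c *\<^sub>C Rep_ell2 f j"
  by (simp add: scaleC_ell2_def Rep_Abs_ell2 ell2_summable_scaleC ell2_summable)

lemma Rep_ell2_scaleR: "Rep_ell2 (r *\<^sub>R f) j = r *\<^sub>R Rep_ell2 f j"
  by (simp add: scaleR_ell2_def scaleR_scaleC Rep_Abs_ell2 ell2_summable_scaleC ell2_summable)

lemmas Rep_ell2_simps = Rep_ell2_zero Rep_ell2_add Rep_ell2_uminus Rep_ell2_diff
  Rep_ell2_scaleC Rep_ell2_scaleR

lemma ell2_eqI: "(\<And>j. Rep_ell2 f j = Rep_ell2 g j) \<Longrightarrow> f = g"
  by (metis Rep_ell2_inject ext)

lemma has_sum_inner_ell2: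
  "((\<lambda>j. inner (Rep_ell2 f j) (Rep_ell2 g j)) has_sum inner f g) UNIV"
  unfolding inner_ell2_def
  by (rule has_sum_infsum) (rule ell2_summable_inner [OF ell2_summable ell2_summable])

lemma has_sum_cinner_ell2:
  "((\<lambda>j. cinner (Rep_ell2 f j) (Rep_ell2 g j)) has_sum cinner f g) UNIV"
  unfolding cinner_ell2_def
  by (rule has_sum_infsum) (rule ell2_summable_cinner [OF ell2_summable ell2_summable])

instance
proof
  fix f g h :: "('a, 'b) ell2" and r s :: real and c d :: complex
  show "f + g + h = f + (g + h)" "f + g = g + f" "0 + f = f" "- f + f = 0" "f - g = f + - g"
    "r *\<^sub>R (f + g) = r *\<^sub>R f + r *\<^sub>R g" "(r + s) *\<^sub>R f = r *\<^sub>R f + s *\<^sub>R f"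
    "r *\<^sub>R s *\<^sub>R f = (r * s) *\<^sub>R f" "1 *\<^sub>R f = f"
    by (auto intro!: ell2_eqI simp: Rep_ell2_simps algebra_simps)
  show "c *\<^sub>C (f + g) = c *\<^sub>C f + c *\<^sub>C g" "(c + d) *\<^sub>C f = c *\<^sub>C f + d *\<^sub>C f"
    "c *\<^sub>C d *\<^sub>C f = (c * d) *\<^sub>C f" "r *\<^sub>R f = of_real r *\<^sub>C f"
    by (auto intro!: ell2_eqI simp: Rep_ell2_simps scaleC_add_right scaleC_add_left
        scaleC_scaleC scaleR_scaleC)
  show "dist f g = norm (f - g)" by (rule dist_ell2_def)
  show "sgn f = inverse (norm f) *\<^sub>R f" by (rule sgn_ell2_def)
  show "uniformity = (INF e\<in>{0<..}. principal {(x, y :: ('a, 'b) ell2). dist x y < e})"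
    by (rule uniformity_ell2_def)
  show "open U = (\<forall>x\<in>U. eventually (\<lambda>(x', y). x' = x \<longrightarrow> y \<in> U) uniformity)"
    for U :: "('a, 'b) ell2 set" by (rule open_ell2_def)
  show "norm f = sqrt (inner f f)" by (rule norm_ell2_def)
  show "inner f g = inner g f" by (simp add: inner_ell2_def inner_commute)
  show "inner (f + g) h = inner f h + inner g h"
    using has_sum_add [OF has_sum_inner_ell2 [of f h] has_sum_inner_ell2 [of g h]]
      has_sum_inner_ell2 [of "f + g" h]
    by (simp add: Rep_ell2_simps inner_add_left) (erule (1) has_sum_unique)
  show "inner (r *\<^sub>R f) g = r * inner f g"
    using has_sum_cmult_right [OF has_sum_inner_ell2 [of f g], of r]
      has_sum_inner_ell2 [of "r *\<^sub>R f" g]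
    by (simp add: Rep_ell2_simps) (erule (1) has_sum_unique)
  show "0 \<le> inner f f" unfolding inner_ell2_def by (rule infsum_nonneg) simp
  show "inner f f = 0 \<longleftrightarrow> f = 0"
  proof
    assume 0: "inner f f = 0"
    show "f = 0"
    proof (rule ell2_eqI)
      fix j
      have "inner (Rep_ell2 f j) (Rep_ell2 f j) = 0"
        using nonneg_has_sum_le_0D [OF has_sum_inner_ell2 [of f f]] 0 by simp
      then show "Rep_ell2 f j = Rep_ell2 0 j" by (simp add: Rep_ell2_zero)
    qed
  qed (simp add: inner_ell2_def Rep_ell2_zero)
  show "cinner f g = cnj (cinner g f)"
    using has_sum_cnj_iff [THEN iffD2, OF has_sum_cinner_ell2 [of g f]] has_sum_cinner_ell2 [of f g]
    by (simp add: cinner_commute [of "Rep_ell2 f _", symmetric]) (erule (1) has_sum_unique)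
  show "cinner (f + g) h = cinner f h + cinner g h"
    using has_sum_add [OF has_sum_cinner_ell2 [of f h] has_sum_cinner_ell2 [of g h]]
      has_sum_cinner_ell2 [of "f + g" h]
    by (simp add: Rep_ell2_simps cinner_add_left) (erule (1) has_sum_unique)
  show "cinner (c *\<^sub>C f) g = c * cinner f g"
    using has_sum_cmult_right [OF has_sum_cinner_ell2 [of f g], of c]
      has_sum_cinner_ell2 [of "c *\<^sub>C f" g]
    by (simp add: Rep_ell2_simps cinner_scaleC_left) (erule (1) has_sum_unique)
  show "Re (cinner f g) = inner f g"
    using has_sum_Re [OF has_sum_cinner_ell2 [of f g]] has_sum_inner_ell2 [of f g]
    by (simp add: Re_cinner) (erule (1) has_sum_unique)
qed

end

lemma has_sum_norm_ell2: "((\<lambda>j. (norm (Rep_ell2 f j))\<^sup>2) has_sum (norm f)\<^sup>2) UNIV"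
  using has_sum_inner_ell2 [of f f] by (simp add: power2_norm_eq_inner)

lemma sum_le_norm_ell2: "finite F \<Longrightarrow> (\<Sum>j\<in>F. (norm (Rep_ell2 f j))\<^sup>2) \<le> (norm f)\<^sup>2"
  using finite_sum_le_has_sum [OF has_sum_norm_ell2 [of f]] by simp

lemma norm_Rep_ell2_le: "norm (Rep_ell2 f j) \<le> norm f"
proof (rule power2_le_imp_le)
  show "(norm (Rep_ell2 f j))\<^sup>2 \<le> (norm f)\<^sup>2"
    using sum_le_norm_ell2 [of "{j}" f] by simp
qed simp

lemma ell2_finite_bound:
  fixes f :: "'j \<Rightarrow> 'a::complex_inner"
  assumes le: "\<And>F. finite F \<Longrightarrow> (\<Sum>j\<in>F. (norm (f j))\<^sup>2) \<le> e\<^sup>2" and "0 \<le> e"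
  shows "(\<lambda>j. (norm (f j))\<^sup>2) summable_on UNIV" and "norm (Abs_ell2 f) \<le> e"
proof -
  have "bdd_above (sum (\<lambda>j. (norm (f j))\<^sup>2) ` {F. F \<subseteq> UNIV \<and> finite F})"
    by (rule bdd_aboveI2 [where M = "e\<^sup>2"], rule le) blast
  then show s: "(\<lambda>j. (norm (f j))\<^sup>2) summable_on UNIV"
    by (rule nonneg_bdd_above_summable_on [rotated]) (rule zero_le_power2)
  have "((\<lambda>j. (norm (f j))\<^sup>2) has_sum (norm (Abs_ell2 f))\<^sup>2) UNIV"
    using has_sum_norm_ell2 [of "Abs_ell2 f"] by (simp only: Rep_Abs_ell2 [OF s])
  then have "(norm (Abs_ell2 f))\<^sup>2 \<le> e\<^sup>2"
    by (rule has_sum_le_finite_sums) (rule le)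
  then show "norm (Abs_ell2 f) \<le> e" using \<open>0 \<le> e\<close> by (rule power2_le_imp_le)
qed

instance ell2 :: (type, chilbert_space) chilbert_space
proof
  fix X :: "nat \<Rightarrow> ('a, 'b) ell2"
  assume X: "Cauchy X"
  have le: "dist (Rep_ell2 x j) (Rep_ell2 y j) \<le> dist x y" for x y :: "('a, 'b) ell2" and j
    using norm_Rep_ell2_le [of "x - y" j] by (simp add: dist_norm Rep_ell2_diff)
  have "Cauchy (\<lambda>n. Rep_ell2 (X n) j)" for j
  proof (rule metric_CauchyI)
    fix e :: real assume "0 < e"
    then obtain N where "\<And>m n. m \<ge> N \<Longrightarrow> n \<ge> N \<Longrightarrow> dist (X m) (X n) < e"
      using metric_CauchyD [OF X] by blast
    then show "\<exists>N. \<forall>m\<ge>N. \<forall>n\<ge>N. dist (Rep_ell2 (X m) j) (Rep_ell2 (X n) j) < e"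
      by (blast intro: order_le_less_trans [OF le])
  qed
  then have "\<exists>l. (\<lambda>n. Rep_ell2 (X n) j) \<longlonglongrightarrow> l" for j
    by (simp add: Cauchy_convergent_iff convergent_def)
  then obtain g where g: "\<And>j. (\<lambda>n. Rep_ell2 (X n) j) \<longlonglongrightarrow> g j"
    by metis
  have bound: "\<exists>N. \<forall>n\<ge>N. \<forall>F. finite F \<longrightarrow> (\<Sum>j\<in>F. (norm (g j - Rep_ell2 (X n) j))\<^sup>2) \<le> e\<^sup>2"
    if "0 < e" for e :: real
  proof -
    obtain N where N: "\<And>m n. m \<ge> N \<Longrightarrow> n \<ge> N \<Longrightarrow> dist (X m) (X n) < e"
      using metric_CauchyD [OF X \<open>0 < e\<close>] by blast
    have "(\<Sum>j\<in>F. (norm (g j - Rep_ell2 (X n) j))\<^sup>2) \<le> e\<^sup>2" if "n \<ge> N" "finite F" for n F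
    proof (rule LIMSEQ_le_const2)
      show "(\<lambda>m. \<Sum>j\<in>F. (norm (Rep_ell2 (X m) j - Rep_ell2 (X n) j))\<^sup>2)
          \<longlonglongrightarrow> (\<Sum>j\<in>F. (norm (g j - Rep_ell2 (X n) j))\<^sup>2)"
        by (intro tendsto_intros g)
      have "(\<Sum>j\<in>F. (norm (Rep_ell2 (X m) j - Rep_ell2 (X n) j))\<^sup>2) \<le> e\<^sup>2" if "m \<ge> N" for m
      proof -
        have "(\<Sum>j\<in>F. (norm (Rep_ell2 (X m) j - Rep_ell2 (X n) j))\<^sup>2) \<le> (norm (X m - X n))\<^sup>2"
          using sum_le_norm_ell2 [OF \<open>finite F\<close>, of "X m - X n"] by (simp add: Rep_ell2_diff)
        also have "\<dots> \<le> e\<^sup>2"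
          using N [OF that \<open>n \<ge> N\<close>] by (intro power_mono) (simp_all add: dist_norm)
        finally show ?thesis .
      qed
      then show "\<exists>N. \<forall>m\<ge>N. (\<Sum>j\<in>F. (norm (Rep_ell2 (X m) j - Rep_ell2 (X n) j))\<^sup>2) \<le> e\<^sup>2"
        by blast
    qed
    then show ?thesis by blast
  qed
  obtain n1 where n1: "\<And>F. finite F \<Longrightarrow> (\<Sum>j\<in>F. (norm (g j - Rep_ell2 (X n1) j))\<^sup>2) \<le> 1\<^sup>2"
    using bound [of 1] by auto
  have "(\<lambda>j. (norm ((g j - Rep_ell2 (X n1) j) + Rep_ell2 (X n1) j))\<^sup>2) summable_on UNIV"
    by (intro ell2_summable_add ell2_summable ell2_finite_bound(1) [where e = 1] n1) simp_all
  then have G: "Rep_ell2 (Abs_ell2 g) = g" by (simp add: Rep_Abs_ell2)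
  have "X \<longlonglongrightarrow> Abs_ell2 g"
  proof (rule metric_LIMSEQ_I)
    fix e :: real assume "0 < e"
    then obtain N where N: "\<And>n F. n \<ge> N \<Longrightarrow> finite F \<Longrightarrow>
        (\<Sum>j\<in>F. (norm (g j - Rep_ell2 (X n) j))\<^sup>2) \<le> (e / 2)\<^sup>2"
      using bound [of "e / 2"] by auto
    have "dist (X n) (Abs_ell2 g) < e" if "n \<ge> N" for n
    proof -
      have "norm (Abs_ell2 (\<lambda>j. g j - Rep_ell2 (X n) j)) \<le> e / 2"
        using \<open>0 < e\<close> by (intro ell2_finite_bound(2) N that) simp_all
      then have "dist (Abs_ell2 g) (X n) \<le> e / 2"
        by (simp add: dist_norm minus_ell2_def G)
      then show ?thesis using \<open>0 < e\<close> dist_commute [of "X n" "Abs_ell2 g"] by linarith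
    qed
    then show "\<exists>N. \<forall>n\<ge>N. dist (X n) (Abs_ell2 g) < e" by blast
  qed
  then show "convergent X" by (auto simp: convergent_def)
qed

definition tensor :: "('j, complex) ell2 \<Rightarrow> 'a::complex_inner \<Rightarrow> ('j, 'a) ell2"  (infixr \<open>\<otimes>\<close> 70)
  where "a \<otimes> h = Abs_ell2 (\<lambda>j. Rep_ell2 a j *\<^sub>C h)"

definition ell2_basis :: "'j \<Rightarrow> ('j, complex) ell2"
  where "ell2_basis j = Abs_ell2 (\<lambda>i. if i = j then 1 else 0)"

lemma Rep_ell2_tensor: "Rep_ell2 (a \<otimes> h) j = Rep_ell2 a j *\<^sub>C h"
proof -
  have "(\<lambda>j. (norm (Rep_ell2 a j *\<^sub>C h))\<^sup>2) summable_on UNIV"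
    using summable_on_cmult_left [OF ell2_summable [of a], of "(norm h)\<^sup>2"]
    by (simp add: norm_scaleC power_mult_distrib)
  then show ?thesis by (simp add: tensor_def Rep_Abs_ell2)
qed

lemma Rep_ell2_basis: "Rep_ell2 (ell2_basis j) i = (if i = j then 1 else 0)"
proof -
  have "(\<lambda>i. (norm (if i = j then 1 else 0 :: complex))\<^sup>2) summable_on UNIV"
    by (rule finite_nonzero_values_imp_summable_on) simp
  then show ?thesis by (simp add: ell2_basis_def Rep_Abs_ell2)
qed

lemma cinner_tensor: "cinner (a \<otimes> x) (b \<otimes> y) = cinner a b * cinner x y"
  using has_sum_cmult_left [OF has_sum_cinner_ell2 [of a b], of "cinner x y"]
    has_sum_cinner_ell2 [of "a \<otimes> x" "b \<otimes> y"]
  by (simp add: Rep_ell2_tensor cinner_scaleC_left cinner_scaleC_right cinner_complex_def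
      mult_ac) (erule (1) has_sum_unique)

lemma Rep_ell2_sum: "Rep_ell2 (\<Sum>i\<in>F. f i) j = (\<Sum>i\<in>F. Rep_ell2 (f i) j)"
  by (induction F rule: infinite_finite_induct) (simp_all add: Rep_ell2_simps)

lemma closure_span_tensor:
  "closure (span {a \<otimes> h |a h. True}) = (UNIV :: ('j, 'a::complex_inner) ell2 set)"
proof (rule set_eqI, rule iffI)
  fix f :: "('j, 'a) ell2"
  show "f \<in> closure (span {a \<otimes> h |a h. True})"
  proof (rule closure_approachable [THEN iffD2], intro allI impI)
    fix e :: real assume "0 < e"
    then have e: "0 < (e / 2)\<^sup>2" by simp
    obtain F where F: "finite F" "dist (\<Sum>j\<in>F. (norm (Rep_ell2 f j))\<^sup>2) ((norm f)\<^sup>2) \<le> (e / 2)\<^sup>2"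
      using has_sum_finite_approximation [OF has_sum_norm_ell2 [of f] e] by blast
    define g where "g = (\<Sum>j\<in>F. ell2_basis j \<otimes> Rep_ell2 f j)"
    have g: "g \<in> span {a \<otimes> h |a h. True}"
      unfolding g_def by (intro span_sum span_base) blast
    have Rg: "Rep_ell2 g j = (if j \<in> F then Rep_ell2 f j else 0)" for j
    proof -
      have "Rep_ell2 g j = (\<Sum>i\<in>F. if i = j then Rep_ell2 f j else 0)"
        unfolding g_def Rep_ell2_sum
        by (intro sum.cong refl)
          (auto simp: Rep_ell2_tensor Rep_ell2_basis scaleR_scaleC [of 1, symmetric, simplified]
            scaleR_scaleC [of 0, symmetric, simplified])
      then show ?thesis using F(1) by simp
    qed
    have "((\<lambda>j. (norm (Rep_ell2 g j))\<^sup>2 + (norm (Rep_ell2 (g - f) j))\<^sup>2)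
        has_sum ((norm g)\<^sup>2 + (norm (g - f))\<^sup>2)) UNIV"
      by (intro has_sum_add has_sum_norm_ell2)
    moreover have "(norm (Rep_ell2 g j))\<^sup>2 + (norm (Rep_ell2 (g - f) j))\<^sup>2
        = (norm (Rep_ell2 f j))\<^sup>2" for j
      by (simp add: Rg Rep_ell2_diff)
    ultimately have "((\<lambda>j. (norm (Rep_ell2 f j))\<^sup>2) has_sum
        ((norm g)\<^sup>2 + (norm (g - f))\<^sup>2)) UNIV"
      by simp
    then have "(norm g)\<^sup>2 + (norm (g - f))\<^sup>2 = (norm f)\<^sup>2"
      by (rule has_sum_unique) (rule has_sum_norm_ell2)
    then have "(norm (g - f))\<^sup>2 = (norm f)\<^sup>2 - (norm g)\<^sup>2" by simp
    also have "(norm g)\<^sup>2 = (\<Sum>j\<in>F. (norm (Rep_ell2 f j))\<^sup>2)"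
    proof -
      have "((\<lambda>j. (norm (Rep_ell2 f j))\<^sup>2) has_sum (norm g)\<^sup>2) F"
        by (rule has_sum_cong_neutral [THEN iffD1, rotated 3, OF has_sum_norm_ell2 [of g]])
          (auto simp: Rg)
      then show ?thesis using F(1) by (simp add: has_sum_finite_iff)
    qed
    finally have "(norm (g - f))\<^sup>2 \<le> (e / 2)\<^sup>2" using F(2) by (simp add: dist_real_def)
    then have "norm (g - f) \<le> e / 2"
      by (rule power2_le_imp_le) (use \<open>0 < e\<close> in simp)
    then have "dist g f < e" using \<open>0 < e\<close> by (simp add: dist_norm)
    with g show "\<exists>y\<in>span {a \<otimes> h |a h. True}. dist y f < e" by blast
  qed
qed simp


section \<open>Bounded operators\<close>

definition bounded_clinear :: "('a::complex_inner \<Rightarrow> 'b::complex_inner) \<Rightarrow> bool"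
  where "bounded_clinear T \<longleftrightarrow> bounded_linear T \<and> (\<forall>c x. T (c *\<^sub>C x) = c *\<^sub>C T x)"

text \<open>Only meaningful for bounded operators between Hilbert spaces, where the adjoint exists
  and is unique.\<close>

definition cadjoint :: "('a::complex_inner \<Rightarrow> 'b::complex_inner) \<Rightarrow> 'b \<Rightarrow> 'a"  (\<open>_\<^sup>\<dagger>\<close> [1000] 1000)
  where "T\<^sup>\<dagger> = (THE T'. \<forall>x y. cinner (T x) y = cinner x (T' y))"

definition positive_op :: "('a::complex_inner \<Rightarrow> 'a) \<Rightarrow> bool"
  where "positive_op T \<longleftrightarrow> (\<forall>x. cinner (T x) x \<in> \<real>\<^sub>\<ge>\<^sub>0)"

definition invertible_op :: "('a::complex_inner \<Rightarrow> 'a) \<Rightarrow> bool"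
  where "invertible_op T \<longleftrightarrow> (\<exists>T'. bounded_clinear T' \<and> T' \<circ> T = id \<and> T \<circ> T' = id)"

text \<open>
  \<open>T = \<Sum>\<^sub>j F\<^sub>j\<close>, the net of finite partial sums converging in the strong operator topology.
  The value of \<open>strong_sum\<close> is only meaningful if that net converges, as it does in its two uses
  below when \<open>A\<close> is an operator-valued frame.
\<close>

definition has_strong_sum ::
    "('j \<Rightarrow> 'a::complex_inner \<Rightarrow> 'b::complex_inner) \<Rightarrow> ('a \<Rightarrow> 'b) \<Rightarrow> bool"
  where "has_strong_sum F T \<longleftrightarrow> (\<forall>x. ((\<lambda>j. F j x) has_sum T x) UNIV)"

definition strong_sum ::
    "('j \<Rightarrow> 'a::complex_inner \<Rightarrow> 'b::complex_inner) \<Rightarrow> 'a \<Rightarrow> 'b"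
  where "strong_sum F = (\<lambda>x. \<Sum>\<^sub>\<infinity>j. F j x)"


section \<open>Operator-valued frames\<close>

definition op_frames :: "('j \<Rightarrow> 'h::chilbert_space \<Rightarrow> 'k::chilbert_space) set"  (\<open>\<F>\<close>)
  where "\<F> = {A. (\<forall>j. bounded_clinear (A j)) \<and>
    (\<exists>S. has_strong_sum (\<lambda>j. (A j)\<^sup>\<dagger> \<circ> A j) S \<and>
      bounded_clinear S \<and> positive_op S \<and> invertible_op S)}"

text \<open>The notions below are intended for families in \<open>\<F>\<close> only; in particular \<open>S\<^bsub>A\<^esub>\<close> is then bijective,
  so that \<open>inv S\<^bsub>A\<^esub>\<close> is its inverse.\<close>

definition frame_op :: "('j \<Rightarrow> 'h::chilbert_space \<Rightarrow> 'k::chilbert_space) \<Rightarrow> 'h \<Rightarrow> 'h"  (\<open>S\<^bsub>_\<^esub>\<close>)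
  where "S\<^bsub>A\<^esub> = strong_sum (\<lambda>j. (A j)\<^sup>\<dagger> \<circ> A j)"

definition embed :: "'j \<Rightarrow> 'k::chilbert_space \<Rightarrow> ('j, 'k) ell2"  (\<open>L\<^bsub>_\<^esub>\<close>)
  where "L\<^bsub>j\<^esub> = (\<lambda>h. ell2_basis j \<otimes> h)"

definition analysis_op ::
    "('j \<Rightarrow> 'h::chilbert_space \<Rightarrow> 'k::chilbert_space) \<Rightarrow> 'h \<Rightarrow> ('j, 'k) ell2"  (\<open>\<theta>\<^bsub>_\<^esub>\<close>)
  where "\<theta>\<^bsub>A\<^esub> = strong_sum (\<lambda>j. L\<^bsub>j\<^esub> \<circ> A j)"

definition frame_proj ::
    "('j \<Rightarrow> 'h::chilbert_space \<Rightarrow> 'k::chilbert_space) \<Rightarrow> ('j, 'k) ell2 \<Rightarrow> ('j, 'k) ell2"  (\<open>P\<^bsub>_\<^esub>\<close>)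
  where "P\<^bsub>A\<^esub> = \<theta>\<^bsub>A\<^esub> \<circ> inv S\<^bsub>A\<^esub> \<circ> \<theta>\<^bsub>A\<^esub>\<^sup>\<dagger>"

definition dual_frame ::
    "('j \<Rightarrow> 'h::chilbert_space \<Rightarrow> 'k::chilbert_space) \<Rightarrow> ('j \<Rightarrow> 'h \<Rightarrow> 'k) \<Rightarrow> bool"
  where "dual_frame A B \<longleftrightarrow> \<theta>\<^bsub>B\<^esub>\<^sup>\<dagger> \<circ> \<theta>\<^bsub>A\<^esub> = id"

definition canonical_dual ::
    "('j \<Rightarrow> 'h::chilbert_space \<Rightarrow> 'k::chilbert_space) \<Rightarrow> 'j \<Rightarrow> 'h \<Rightarrow> 'k"
  where "canonical_dual A = (\<lambda>j. A j \<circ> inv S\<^bsub>A\<^esub>)"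

definition Phi ::
    "('j \<Rightarrow> 'h::chilbert_space \<Rightarrow> 'k::chilbert_space) \<Rightarrow> ('j \<Rightarrow> 'h \<Rightarrow> 'k)
      \<Rightarrow> ('j, 'k) ell2 \<Rightarrow> ('j, 'k) ell2"  (\<open>\<Phi>\<^bsub>_\<^esub>\<close>)
  where "\<Phi>\<^bsub>A\<^esub> B = \<theta>\<^bsub>B\<^esub> \<circ> inv S\<^bsub>A\<^esub> \<circ> \<theta>\<^bsub>A\<^esub>\<^sup>\<dagger>"

end

theory Submission
  imports Defs
begin

text \<open>
  The proof factors every operator in the statement through the analysis operators. For a frame
  \<open>A\<close>, convergence of \<open>\<Sum>\<^sub>j A\<^sub>j\<^sup>* A\<^sub>j\<close> makes \<open>(A\<^sub>j x)\<^sub>j\<close> square-summable, and \<open>\<theta>\<^sub>A x\<close> is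
  this family (\<open>Rep_ell2_analysis_op\<close>). A square-summable family is the norm limit of its finite
  truncations (\<open>has_sum_embed_components\<close>). Applying the bounded operator \<open>\<theta>\<^sub>B\<^sup>*\<close> to the resulting
  expansion of \<open>\<theta>\<^sub>A x\<close>, and using \<open>\<theta>\<^sub>B\<^sup>* L\<^sub>j = B\<^sub>j\<^sup>*\<close>, shows that \<open>\<Sum>\<^sub>j B\<^sub>j\<^sup>* A\<^sub>j\<close> always
  converges strongly to \<open>\<theta>\<^sub>B\<^sup>* \<theta>\<^sub>A\<close> (\<open>has_strong_sum_adjoint_comp\<close>). This is the equivalence of (i)
  and (ii), and for \<open>B = A\<close> it gives \<open>\<theta>\<^sub>A\<^sup>* \<theta>\<^sub>A = S\<^sub>A\<close>.

  Since \<open>S\<^sub>A\<close> is bijective, \<open>\<theta>\<^sub>A\<close> is injective and \<open>\<theta>\<^sub>A\<^sup>*\<close> is surjective. The relation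
  \<open>\<theta>\<^sub>A\<^sup>* \<theta>\<^sub>A = S\<^sub>A\<close> also reduces \<open>P\<^sub>A M P\<^sub>A\<close> to
  \<open>\<theta>\<^sub>A S\<^sub>A\<^sup>-\<^sup>1 (\<theta>\<^sub>A\<^sup>* \<theta>\<^sub>B) S\<^sub>A\<^sup>-\<^sup>1 \<theta>\<^sub>A\<^sup>*\<close>, so cancelling on both sides turns (iii) into
  \<open>\<theta>\<^sub>A\<^sup>* \<theta>\<^sub>B = I\<close>, the adjoint of (i). Finally, given duality, \<open>M = P\<^sub>A M P\<^sub>A\<close> reads
  \<open>\<theta>\<^sub>B S\<^sub>A\<^sup>-\<^sup>1 \<theta>\<^sub>A\<^sup>* = \<theta>\<^sub>A S\<^sub>A\<^sup>-\<^sup>2 \<theta>\<^sub>A\<^sup>*\<close>; cancelling the surjection \<open>S\<^sub>A\<^sup>-\<^sup>1 \<theta>\<^sub>A\<^sup>*\<close> leaves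
  \<open>\<theta>\<^sub>B = \<theta>\<^sub>A S\<^sub>A\<^sup>-\<^sup>1\<close>, which says componentwise that \<open>B\<close> is the canonical dual.
  Conversely \<open>\<theta>\<^sub>B = \<theta>\<^sub>A S\<^sub>A\<^sup>-\<^sup>1\<close> gives \<open>\<theta>\<^sub>A\<^sup>* \<theta>\<^sub>B = I\<close>, so the canonical dual is a dual, and
  then \<open>P\<^sub>A M P\<^sub>A = \<theta>\<^sub>A S\<^sub>A\<^sup>-\<^sup>2 \<theta>\<^sub>A\<^sup>* = M\<close> by (iii).

  Existence of adjoints rests on the Riesz representation theorem, which is proved first. Because
  the real part of the complex inner product is the real one, all computations with adjoints are
  carried out for the real inner product.
\<close>

section \<open>Riesz representation and adjoints\<close>

text \<open>
  The representing vector is the minimiser of \<open>\<parallel>x\<parallel>\<^sup>2 - 2 f x\<close>. The parallelogram law makes every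
  minimising sequence of this functional Cauchy.
\<close>

lemma riesz_representation:
  fixes f :: "'a::{real_inner, complete_space} \<Rightarrow> real"
  assumes "bounded_linear f"
  obtains z where "\<And>x. f x = inner x z"
proof -
  interpret f: bounded_linear f by (rule assms)
  define E where "E x = (norm x)\<^sup>2 - 2 * f x" for x
  define m where "m = Inf (range E)"
  obtain K where K: "\<And>x. norm (f x) \<le> norm x * K" using f.bounded by blast
  have "- (K\<^sup>2) \<le> E x" for x
  proof -
    have "2 * f x \<le> 2 * (norm x * K)" using K [of x] by simp
    also have "\<dots> \<le> (norm x)\<^sup>2 + K\<^sup>2" using sum_squares_bound [of "norm x" K] by simp
    finally show ?thesis by (simp add: E_def)
  qed
  then have bdd: "bdd_below (range E)" by (meson bdd_belowI2)
  have m: "m \<le> E x" for x unfolding m_def by (rule cInf_lower [OF rangeI bdd])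
  have "\<exists>x. E x < m + 1 / real (Suc n)" for n
    using cInf_lessD [of "range E" "m + 1 / real (Suc n)"] by (auto simp: m_def)
  then obtain X where X: "\<And>n. E (X n) < m + 1 / real (Suc n)" by metis
  have parallelogram: "(norm (x - y))\<^sup>2 = 2 * E x + 2 * E y - 4 * E ((1/2) *\<^sub>R (x + y))" for x y
    unfolding E_def power2_norm_eq_inner
    by (simp add: inner_simps f.add f.scaleR inner_commute [of y x] algebra_simps)
  have "Cauchy X"
  proof (rule metric_CauchyI)
    fix e :: real assume "0 < e"
    then obtain N where N: "1 / real (Suc N) < e\<^sup>2 / 4"
      using nat_approx_posE [of "e\<^sup>2 / 4"] by auto
    have E: "E (X n) < m + e\<^sup>2 / 4" if "n \<ge> N" for n
    proof -
      have "1 / real (Suc n) \<le> 1 / real (Suc N)" using that by (intro divide_left_mono) auto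
      then show ?thesis using X [of n] N by linarith
    qed
    have "dist (X i) (X j) < e" if "i \<ge> N" "j \<ge> N" for i j
    proof -
      have "(norm (X i - X j))\<^sup>2 < e\<^sup>2"
        using parallelogram [of "X i" "X j"] E [OF that(1)] E [OF that(2)]
          m [of "(1/2) *\<^sub>R (X i + X j)"] by linarith
      then show ?thesis using \<open>0 < e\<close> by (simp add: dist_norm power2_less_imp_less)
    qed
    then show "\<exists>N. \<forall>i\<ge>N. \<forall>j\<ge>N. dist (X i) (X j) < e" by blast
  qed
  then obtain z where z: "X \<longlonglongrightarrow> z" using Cauchy_convergent_iff convergent_def by blast
  have "(\<lambda>n. E (X n)) \<longlonglongrightarrow> E z"
    unfolding E_def by (intro tendsto_intros f.tendsto z)
  moreover have "(\<lambda>n. m + 1 / real (Suc n)) \<longlonglongrightarrow> m"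
    using tendsto_add [OF tendsto_const [of m] LIMSEQ_inverse_real_of_nat]
    by (simp add: inverse_eq_divide)
  ultimately have "E z \<le> m"
    by (rule LIMSEQ_le) (use X less_imp_le in blast)
  have "f x = inner x z" for x
  proof (cases "x = 0")
    case False
    \<comment> \<open>The value of \<open>t\<close> minimises \<open>E (z + t x)\<close>, a quadratic polynomial in \<open>t\<close>.\<close>
    define t where "t = (f x - inner x z) / (norm x)\<^sup>2"
    have "E (z + t *\<^sub>R x) = E z + t\<^sup>2 * (norm x)\<^sup>2 - 2 * t * (f x - inner x z)"
      unfolding E_def power2_norm_eq_inner
      by (simp add: inner_simps f.add f.scaleR inner_commute [of z x] algebra_simps power2_eq_square)
    also have "\<dots> = E z - (f x - inner x z)\<^sup>2 / (norm x)\<^sup>2"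
      using False by (simp add: t_def field_simps power2_eq_square)
    finally have "(f x - inner x z)\<^sup>2 / (norm x)\<^sup>2 \<le> 0"
      using m [of "z + t *\<^sub>R x"] \<open>E z \<le> m\<close> by linarith
    then show ?thesis using False by (simp add: divide_le_0_iff)
  qed (simp add: f.zero)
  then show thesis by (rule that)
qed

lemma inner_ext: "(\<And>x. inner x y = inner x z) \<Longrightarrow> y = z" for y z :: "'a::real_inner"
  by (metis eq_iff_diff_eq_0 inner_diff_right inner_eq_zero_iff)

lemma inner_cadjoint:
  fixes T :: "'a::chilbert_space \<Rightarrow> 'b::complex_inner"
  assumes "bounded_clinear T"
  shows "inner x (T\<^sup>\<dagger> y) = inner (T x) y"
proof -
  have T: "bounded_linear T" and TC: "\<And>c x. T (c *\<^sub>C x) = c *\<^sub>C T x"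
    using assms by (auto simp: bounded_clinear_def)
  have "\<exists>z. \<forall>x. inner (T x) y = inner x z" for y
    by (rule riesz_representation [of "\<lambda>x. inner (T x) y"])
      (auto intro: bounded_linear_compose [OF bounded_linear_inner_left T])
  then obtain T' where T': "\<And>x y. inner (T x) y = inner x (T' y)" by metis
  have "T\<^sup>\<dagger> = T'"
    unfolding cadjoint_def
  proof (rule the_equality)
    show "\<forall>x y. cinner (T x) y = cinner x (T' y)"
      by (simp add: cinner_eq [of "T _"] cinner_eq [of _ "T' _"] TC [symmetric] T')
    fix U assume "\<forall>x y. cinner (T x) y = cinner x (U y)"
    then have "inner x (U y) = inner x (T' y)" for x y
      by (metis Re_cinner T')
    then show "U = T'" by (intro ext) (rule inner_ext)
  qed
  then show ?thesis by (simp add: T')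
qed

lemma bounded_linear_cadjoint:
  fixes T :: "'a::chilbert_space \<Rightarrow> 'b::complex_inner"
  assumes "bounded_clinear T"
  shows "bounded_linear (T\<^sup>\<dagger>)"
proof -
  interpret T: bounded_linear T using assms by (simp add: bounded_clinear_def)
  note adj = inner_cadjoint [OF assms]
  obtain K where "0 < K" and K: "\<And>x. norm (T x) \<le> norm x * K" using T.pos_bounded by blast
  show ?thesis
  proof (rule bounded_linear_intro)
    show "(T\<^sup>\<dagger>) (x + y) = (T\<^sup>\<dagger>) x + (T\<^sup>\<dagger>) y" for x y
      by (rule inner_ext) (simp add: adj inner_add_right)
    show "(T\<^sup>\<dagger>) (r *\<^sub>R x) = r *\<^sub>R (T\<^sup>\<dagger>) x" for r x
      by (rule inner_ext) (simp add: adj)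
    show "norm ((T\<^sup>\<dagger>) y) \<le> norm y * K" for y
    proof (cases "(T\<^sup>\<dagger>) y = 0")
      case False
      have "norm ((T\<^sup>\<dagger>) y) * norm ((T\<^sup>\<dagger>) y) = inner (T ((T\<^sup>\<dagger>) y)) y"
        by (simp add: adj [symmetric] power2_norm_eq_inner [symmetric] power2_eq_square)
      also have "\<dots> \<le> norm (T ((T\<^sup>\<dagger>) y)) * norm y" by (rule norm_cauchy_schwarz)
      also have "\<dots> \<le> norm ((T\<^sup>\<dagger>) y) * K * norm y" by (intro mult_right_mono K) simp
      finally show ?thesis using False by (simp add: mult.assoc mult.commute)
    qed (use \<open>0 < K\<close> in simp)
  qed
qed

section \<open>Coordinates in \<open>\<ell>\<^sup>2(J) \<otimes> H\<close>\<close>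

lemma Rep_ell2_embed: "Rep_ell2 (L\<^bsub>j\<^esub> h) i = (if i = j then h else 0)"
  by (simp add: embed_def Rep_ell2_tensor Rep_ell2_basis scaleR_scaleC [of 1, symmetric, simplified]
      scaleR_scaleC [of 0, symmetric, simplified])

text \<open>\<open>L\<^sub>j\<close> is adjoint to evaluation at the coordinate \<open>j\<close>.\<close>

lemma inner_embed: "inner (L\<^bsub>j\<^esub> h) f = inner h (Rep_ell2 f j)"
proof -
  have "((\<lambda>i. inner (Rep_ell2 (L\<^bsub>j\<^esub> h) i) (Rep_ell2 f i)) has_sum inner h (Rep_ell2 f j)) {j}"
    by (simp add: has_sum_finite_iff Rep_ell2_embed)
  then have "((\<lambda>i. inner (Rep_ell2 (L\<^bsub>j\<^esub> h) i) (Rep_ell2 f i)) has_sum inner h (Rep_ell2 f j)) UNIV"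
    by (rule has_sum_cong_neutral [THEN iffD1, rotated 3]) (auto simp: Rep_ell2_embed)
  then show ?thesis by (rule has_sum_unique [OF has_sum_inner_ell2])
qed

text \<open>
  The truncation of \<open>f\<close> to a finite set \<open>F\<close> is an orthogonal projection of \<open>f\<close>, so the squared
  error is \<open>\<parallel>f\<parallel>\<^sup>2\<close> minus the partial sum over \<open>F\<close> of the series for \<open>\<parallel>f\<parallel>\<^sup>2\<close>.
\<close>

lemma has_sum_embed_components: "((\<lambda>j. L\<^bsub>j\<^esub> (Rep_ell2 f j)) has_sum f) UNIV"
proof -
  define g where "g F = (\<Sum>j\<in>F. L\<^bsub>j\<^esub> (Rep_ell2 f j))" for F
  have *: "(norm (g F - f))\<^sup>2 = (norm f)\<^sup>2 - (\<Sum>j\<in>F. (norm (Rep_ell2 f j))\<^sup>2)" if "finite F" for F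
  proof -
    have "Rep_ell2 (g F) j = Rep_ell2 f j" if "j \<in> F" for j
      using \<open>finite F\<close> that by (simp add: g_def Rep_ell2_sum Rep_ell2_embed)
    then have "inner (g F) (g F) = (\<Sum>j\<in>F. (norm (Rep_ell2 f j))\<^sup>2)"
      by (subst (1) g_def) (simp add: inner_sum_left inner_embed power2_norm_eq_inner)
    moreover have "inner (g F) f = (\<Sum>j\<in>F. (norm (Rep_ell2 f j))\<^sup>2)"
      by (simp add: g_def inner_sum_left inner_embed power2_norm_eq_inner)
    ultimately show ?thesis
      by (simp add: power2_norm_eq_inner inner_diff_left inner_diff_right inner_commute)
  qed
  have "((\<lambda>F. (norm f)\<^sup>2 - (\<Sum>j\<in>F. (norm (Rep_ell2 f j))\<^sup>2)) \<longlongrightarrow> (norm f)\<^sup>2 - (norm f)\<^sup>2)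
      (finite_subsets_at_top UNIV)"
    using has_sum_norm_ell2 [of f] by (intro tendsto_diff tendsto_const) (simp add: has_sum_def)
  then have "((\<lambda>F. (norm (g F - f))\<^sup>2) \<longlongrightarrow> 0) (finite_subsets_at_top UNIV)"
    by (rule Lim_transform_eventually [where f = "\<lambda>F. _ F", THEN tendsto_eq_rhs])
      (auto intro!: eventually_finite_subsets_at_top_weakI simp: *)
  then have "((\<lambda>F. sqrt ((norm (g F - f))\<^sup>2)) \<longlongrightarrow> sqrt 0) (finite_subsets_at_top UNIV)"
    by (rule tendsto_real_sqrt)
  then have "(g \<longlongrightarrow> f) (finite_subsets_at_top UNIV)"
    by (simp add: tendsto_norm_zero_iff LIM_zero_iff)
  then show ?thesis by (simp add: has_sum_def g_def [abs_def])
qed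

section \<open>The analysis operator\<close>

lemma op_frames_bounded_clinear: "A \<in> \<F> \<Longrightarrow> bounded_clinear (A j)"
  by (simp add: op_frames_def)

lemma has_strong_sum_imp_strong_sum: "has_strong_sum F T \<Longrightarrow> strong_sum F = T"
  by (auto simp: has_strong_sum_def strong_sum_def infsumI)

lemma frame_op_properties:
  assumes "A \<in> \<F>"
  shows "has_strong_sum (\<lambda>j. (A j)\<^sup>\<dagger> \<circ> A j) S\<^bsub>A\<^esub>"
    and "bounded_clinear S\<^bsub>A\<^esub>" and "bij S\<^bsub>A\<^esub>"
proof -
  obtain S where S: "has_strong_sum (\<lambda>j. (A j)\<^sup>\<dagger> \<circ> A j) S" "bounded_clinear S" "invertible_op S"
    using assms by (auto simp: op_frames_def)
  have "S\<^bsub>A\<^esub> = S" using S(1) by (simp add: frame_op_def has_strong_sum_imp_strong_sum)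
  moreover have "bij S" using S(3) by (auto simp: invertible_op_def intro: o_bij)
  ultimately show "has_strong_sum (\<lambda>j. (A j)\<^sup>\<dagger> \<circ> A j) S\<^bsub>A\<^esub>" "bounded_clinear S\<^bsub>A\<^esub>" "bij S\<^bsub>A\<^esub>"
    using S by simp_all
qed

lemma has_sum_norm_frame:
  assumes "A \<in> \<F>"
  shows "((\<lambda>j. (norm (A j x))\<^sup>2) has_sum inner x (S\<^bsub>A\<^esub> x)) UNIV"
proof -
  have "((\<lambda>j. ((A j)\<^sup>\<dagger>) (A j x)) has_sum S\<^bsub>A\<^esub> x) UNIV"
    using frame_op_properties(1) [OF assms] by (simp add: has_strong_sum_def)
  from has_sum_bounded_linear [OF bounded_linear_inner_right this, of x] show ?thesis
    by (simp add: inner_cadjoint op_frames_bounded_clinear [OF assms] power2_norm_eq_inner)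
qed

lemma has_strong_sum_analysis_op:
  assumes "A \<in> \<F>"
  shows "has_strong_sum (\<lambda>j. L\<^bsub>j\<^esub> \<circ> A j) \<theta>\<^bsub>A\<^esub>"
    and Rep_ell2_analysis_op: "Rep_ell2 (\<theta>\<^bsub>A\<^esub> x) j = A j x"
proof -
  have R: "Rep_ell2 (Abs_ell2 (\<lambda>j. A j x)) = (\<lambda>j. A j x)" for x
    using has_sum_norm_frame [OF assms] by (intro Rep_Abs_ell2 has_sum_imp_summable)
  have "has_strong_sum (\<lambda>j. L\<^bsub>j\<^esub> \<circ> A j) (\<lambda>x. Abs_ell2 (\<lambda>j. A j x))"
    unfolding has_strong_sum_def
    using has_sum_embed_components [of "Abs_ell2 (\<lambda>j. A j _)"] by (simp add: R)
  moreover from this have "\<theta>\<^bsub>A\<^esub> = (\<lambda>x. Abs_ell2 (\<lambda>j. A j x))"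
    unfolding analysis_op_def by (rule has_strong_sum_imp_strong_sum)
  ultimately show "has_strong_sum (\<lambda>j. L\<^bsub>j\<^esub> \<circ> A j) \<theta>\<^bsub>A\<^esub>" "Rep_ell2 (\<theta>\<^bsub>A\<^esub> x) j = A j x"
    by (simp_all add: R)
qed

lemma bounded_clinear_analysis_op:
  assumes "A \<in> \<F>"
  shows "bounded_clinear \<theta>\<^bsub>A\<^esub>"
proof -
  note R = Rep_ell2_analysis_op [OF assms]
  have AL: "linear (A j)" and AC: "A j (c *\<^sub>C x) = c *\<^sub>C A j x" for j c x
    using op_frames_bounded_clinear [OF assms, of j]
    by (auto simp: bounded_clinear_def bounded_linear.linear)
  have "bounded_linear S\<^bsub>A\<^esub>"
    using frame_op_properties(2) [OF assms] by (simp add: bounded_clinear_def)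
  then obtain K where "0 < K" and K: "\<And>x. norm (S\<^bsub>A\<^esub> x) \<le> norm x * K"
    using bounded_linear.pos_bounded by blast
  have "bounded_linear \<theta>\<^bsub>A\<^esub>"
  proof (rule bounded_linear_intro)
    show "\<theta>\<^bsub>A\<^esub> (x + y) = \<theta>\<^bsub>A\<^esub> x + \<theta>\<^bsub>A\<^esub> y" for x y
      by (rule ell2_eqI) (simp add: R Rep_ell2_simps linear_add AL)
    show "\<theta>\<^bsub>A\<^esub> (r *\<^sub>R x) = r *\<^sub>R \<theta>\<^bsub>A\<^esub> x" for r x
      by (rule ell2_eqI) (simp add: R Rep_ell2_simps linear_scale AL)
    fix x
    have "(norm (\<theta>\<^bsub>A\<^esub> x))\<^sup>2 = inner x (S\<^bsub>A\<^esub> x)"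
      using has_sum_norm_ell2 [of "\<theta>\<^bsub>A\<^esub> x"] has_sum_norm_frame [OF assms, of x]
      by (simp add: R) (erule (1) has_sum_unique)
    also have "\<dots> \<le> norm x * norm (S\<^bsub>A\<^esub> x)" by (rule norm_cauchy_schwarz)
    also have "\<dots> \<le> norm x * (norm x * K)" by (intro mult_left_mono K) simp
    also have "\<dots> = (norm x * sqrt K)\<^sup>2"
      using \<open>0 < K\<close> by (simp add: power_mult_distrib power2_eq_square)
    finally show "norm (\<theta>\<^bsub>A\<^esub> x) \<le> norm x * sqrt K"
      by (rule power2_le_imp_le) (use \<open>0 < K\<close> in simp)
  qed
  moreover have "\<theta>\<^bsub>A\<^esub> (c *\<^sub>C x) = c *\<^sub>C \<theta>\<^bsub>A\<^esub> x" for c x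
    by (rule ell2_eqI) (simp add: R Rep_ell2_simps AC)
  ultimately show ?thesis by (simp add: bounded_clinear_def)
qed

lemma cadjoint_analysis_op_embed:
  assumes "B \<in> \<F>"
  shows "(\<theta>\<^bsub>B\<^esub>\<^sup>\<dagger>) (L\<^bsub>j\<^esub> h) = ((B j)\<^sup>\<dagger>) h"
proof (rule inner_ext)
  fix x
  show "inner x ((\<theta>\<^bsub>B\<^esub>\<^sup>\<dagger>) (L\<^bsub>j\<^esub> h)) = inner x (((B j)\<^sup>\<dagger>) h)"
    using inner_embed [of j h "\<theta>\<^bsub>B\<^esub> x"]
    by (simp add: inner_cadjoint bounded_clinear_analysis_op op_frames_bounded_clinear assms
        Rep_ell2_analysis_op inner_commute)
qed

lemma has_strong_sum_adjoint_comp: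
  assumes "A \<in> \<F>" and "B \<in> \<F>"
  shows "has_strong_sum (\<lambda>j. (B j)\<^sup>\<dagger> \<circ> A j) (\<theta>\<^bsub>B\<^esub>\<^sup>\<dagger> \<circ> \<theta>\<^bsub>A\<^esub>)"
  unfolding has_strong_sum_def
proof
  fix x
  have "((\<lambda>j. L\<^bsub>j\<^esub> (A j x)) has_sum \<theta>\<^bsub>A\<^esub> x) UNIV"
    using has_strong_sum_analysis_op(1) [OF assms(1)] by (simp add: has_strong_sum_def)
  from has_sum_bounded_linear
      [OF bounded_linear_cadjoint [OF bounded_clinear_analysis_op [OF assms(2)]] this]
  show "((\<lambda>j. ((B j)\<^sup>\<dagger> \<circ> A j) x) has_sum (\<theta>\<^bsub>B\<^esub>\<^sup>\<dagger> \<circ> \<theta>\<^bsub>A\<^esub>) x) UNIV"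
    by (simp add: cadjoint_analysis_op_embed assms(2))
qed

lemma cadjoint_analysis_op_comp_self:
  assumes "A \<in> \<F>"
  shows "(\<theta>\<^bsub>A\<^esub>\<^sup>\<dagger>) (\<theta>\<^bsub>A\<^esub> x) = S\<^bsub>A\<^esub> x"
  using has_strong_sum_imp_strong_sum [OF has_strong_sum_adjoint_comp [OF assms assms]]
  by (metis comp_apply frame_op_def)

section \<open>Duality\<close>

lemma dual_frame_iff_strong_sum:
  assumes "A \<in> \<F>" and "B \<in> \<F>"
  shows "dual_frame A B \<longleftrightarrow> has_strong_sum (\<lambda>j. (B j)\<^sup>\<dagger> \<circ> A j) id"
  using has_strong_sum_adjoint_comp [OF assms] has_strong_sum_imp_strong_sum
  unfolding dual_frame_def by metis

lemma dual_frame_commute: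
  assumes "A \<in> \<F>" and "B \<in> \<F>" and "dual_frame A B"
  shows "dual_frame B A"
  unfolding dual_frame_def
proof (rule ext, rule inner_ext)
  note adj = inner_cadjoint [OF bounded_clinear_analysis_op]
  fix x y
  have "(\<theta>\<^bsub>B\<^esub>\<^sup>\<dagger>) (\<theta>\<^bsub>A\<^esub> y) = y"
    using assms(3) by (metis comp_apply dual_frame_def id_apply)
  then have "inner x y = inner (\<theta>\<^bsub>B\<^esub> x) (\<theta>\<^bsub>A\<^esub> y)"
    using adj [OF assms(2), of x "\<theta>\<^bsub>A\<^esub> y"] by simp
  then show "inner y ((\<theta>\<^bsub>A\<^esub>\<^sup>\<dagger> \<circ> \<theta>\<^bsub>B\<^esub>) x) = inner y (id x)"
    by (simp add: adj [OF assms(1)] inner_commute)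
qed

lemma frame_proj_Phi_frame_proj:
  assumes "A \<in> \<F>"
  shows "(P\<^bsub>A\<^esub> \<circ> \<Phi>\<^bsub>A\<^esub> B \<circ> P\<^bsub>A\<^esub>) f
    = \<theta>\<^bsub>A\<^esub> (inv S\<^bsub>A\<^esub> ((\<theta>\<^bsub>A\<^esub>\<^sup>\<dagger>) (\<theta>\<^bsub>B\<^esub> (inv S\<^bsub>A\<^esub> ((\<theta>\<^bsub>A\<^esub>\<^sup>\<dagger>) f)))))"
  by (simp add: frame_proj_def Phi_def cadjoint_analysis_op_comp_self [OF assms]
      bij_is_surj [OF frame_op_properties(3) [OF assms]] surj_f_inv_f)

theorem proposition5p3:
  fixes A B :: "'j \<Rightarrow> 'h::chilbert_space \<Rightarrow> 'k::chilbert_space"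
    and M :: "('j, 'k) ell2 \<Rightarrow> ('j, 'k) ell2"
  assumes "A \<in> \<F>" and "B \<in> \<F>"
    and "M = \<Phi>\<^bsub>A\<^esub> B"
  shows "(dual_frame A B \<longleftrightarrow> has_strong_sum (\<lambda>j. (B j)\<^sup>\<dagger> \<circ> A j) id) \<and>
    (dual_frame A B \<longleftrightarrow> P\<^bsub>A\<^esub> \<circ> M \<circ> P\<^bsub>A\<^esub> = \<theta>\<^bsub>A\<^esub> \<circ> inv S\<^bsub>A\<^esub> \<circ> inv S\<^bsub>A\<^esub> \<circ> \<theta>\<^bsub>A\<^esub>\<^sup>\<dagger>) \<and>
    (B = canonical_dual A \<longleftrightarrow> dual_frame A B \<and> M = P\<^bsub>A\<^esub> \<circ> M \<circ> P\<^bsub>A\<^esub>)"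
proof (intro conjI)
  note A = assms(1) and B = assms(2)
  note S = cadjoint_analysis_op_comp_self [OF A]
  note PMP = frame_proj_Phi_frame_proj [OF A, of B, folded assms(3)]
  have surj_S: "S\<^bsub>A\<^esub> (inv S\<^bsub>A\<^esub> x) = x" and inj_S: "inv S\<^bsub>A\<^esub> (S\<^bsub>A\<^esub> x) = x" for x
    using frame_op_properties(3) [OF A] by (simp_all add: bij_is_surj surj_f_inv_f bij_is_inj)
  have inj_\<theta>: "x = y" if "\<theta>\<^bsub>A\<^esub> x = \<theta>\<^bsub>A\<^esub> y" for x y
    using that by (metis S inj_S)
  \<comment> \<open>A right inverse of \<open>S\<^sub>A\<^sup>-\<^sup>1 \<theta>\<^sub>A\<^sup>*\<close> is \<open>\<theta>\<^sub>A\<close> itself.\<close>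
  have right_inv: "inv S\<^bsub>A\<^esub> ((\<theta>\<^bsub>A\<^esub>\<^sup>\<dagger>) (\<theta>\<^bsub>A\<^esub> x)) = x" for x
    by (simp add: S inj_S)
  have dual: "dual_frame A B \<longleftrightarrow> (\<forall>x. (\<theta>\<^bsub>A\<^esub>\<^sup>\<dagger>) (\<theta>\<^bsub>B\<^esub> x) = x)"
    using dual_frame_commute [OF A B] dual_frame_commute [OF B A]
    by (auto simp: dual_frame_def fun_eq_iff)
  show "dual_frame A B \<longleftrightarrow> has_strong_sum (\<lambda>j. (B j)\<^sup>\<dagger> \<circ> A j) id"
    by (rule dual_frame_iff_strong_sum [OF A B])
  show iii: "dual_frame A B \<longleftrightarrow>
      P\<^bsub>A\<^esub> \<circ> M \<circ> P\<^bsub>A\<^esub> = \<theta>\<^bsub>A\<^esub> \<circ> inv S\<^bsub>A\<^esub> \<circ> inv S\<^bsub>A\<^esub> \<circ> \<theta>\<^bsub>A\<^esub>\<^sup>\<dagger>"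
  proof
    assume "dual_frame A B"
    then show "P\<^bsub>A\<^esub> \<circ> M \<circ> P\<^bsub>A\<^esub> = \<theta>\<^bsub>A\<^esub> \<circ> inv S\<^bsub>A\<^esub> \<circ> inv S\<^bsub>A\<^esub> \<circ> \<theta>\<^bsub>A\<^esub>\<^sup>\<dagger>"
      by (intro ext) (simp only: PMP, simp add: dual)
  next
    assume eq: "P\<^bsub>A\<^esub> \<circ> M \<circ> P\<^bsub>A\<^esub> = \<theta>\<^bsub>A\<^esub> \<circ> inv S\<^bsub>A\<^esub> \<circ> inv S\<^bsub>A\<^esub> \<circ> \<theta>\<^bsub>A\<^esub>\<^sup>\<dagger>"
    have "(\<theta>\<^bsub>A\<^esub>\<^sup>\<dagger>) (\<theta>\<^bsub>B\<^esub> x) = x" for x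
    proof -
      have "\<theta>\<^bsub>A\<^esub> (inv S\<^bsub>A\<^esub> ((\<theta>\<^bsub>A\<^esub>\<^sup>\<dagger>) (\<theta>\<^bsub>B\<^esub> x))) = \<theta>\<^bsub>A\<^esub> (inv S\<^bsub>A\<^esub> x)"
        using PMP [of "\<theta>\<^bsub>A\<^esub> x"] by (simp only: eq right_inv comp_apply)
      then show ?thesis by (metis inj_\<theta> surj_S)
    qed
    then show "dual_frame A B" by (simp add: dual)
  qed
  show "B = canonical_dual A \<longleftrightarrow> dual_frame A B \<and> M = P\<^bsub>A\<^esub> \<circ> M \<circ> P\<^bsub>A\<^esub>"
  proof
    assume "B = canonical_dual A"
    then have "B j x = A j (inv S\<^bsub>A\<^esub> x)" for j x by (simp add: canonical_dual_def)
    then have \<theta>B: "\<theta>\<^bsub>B\<^esub> x = \<theta>\<^bsub>A\<^esub> (inv S\<^bsub>A\<^esub> x)" for x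
      by (intro ell2_eqI) (simp add: Rep_ell2_analysis_op [OF A] Rep_ell2_analysis_op [OF B])
    then have "dual_frame A B" by (simp add: dual S surj_S)
    moreover have "M = \<theta>\<^bsub>A\<^esub> \<circ> inv S\<^bsub>A\<^esub> \<circ> inv S\<^bsub>A\<^esub> \<circ> \<theta>\<^bsub>A\<^esub>\<^sup>\<dagger>"
      by (auto simp: assms(3) Phi_def \<theta>B)
    ultimately show "dual_frame A B \<and> M = P\<^bsub>A\<^esub> \<circ> M \<circ> P\<^bsub>A\<^esub>" using iii by simp
  next
    assume *: "dual_frame A B \<and> M = P\<^bsub>A\<^esub> \<circ> M \<circ> P\<^bsub>A\<^esub>"
    then have M: "M = \<theta>\<^bsub>A\<^esub> \<circ> inv S\<^bsub>A\<^esub> \<circ> inv S\<^bsub>A\<^esub> \<circ> \<theta>\<^bsub>A\<^esub>\<^sup>\<dagger>" using iii by metis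
    have "\<theta>\<^bsub>B\<^esub> x = \<theta>\<^bsub>A\<^esub> (inv S\<^bsub>A\<^esub> x)" for x
      using fun_cong [OF M, of "\<theta>\<^bsub>A\<^esub> x"] by (simp add: assms(3) Phi_def right_inv)
    then have "B j x = A j (inv S\<^bsub>A\<^esub> x)" for j x
      by (metis Rep_ell2_analysis_op A B)
    then show "B = canonical_dual A" by (simp add: canonical_dual_def fun_eq_iff)
  qed
qed

end
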